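(* Let $(X,d)$ be a metric space and $x_0\in X$. Let $(\cdot\mid\cdot)$ be a pre-controlled product on $X$ at $x_0$, let $\partial X$ be the Gromov boundary of $X$ with respect to $(\cdot\mid\cdot)$, and let $\overline{X}=X\cup\partial X$ be equipped with its topology determined by $(\cdot\mid\cdot)$ and $d$ (defined in the context). Then $\overline{X}$ is compact if and only if $(X,d)$ is proper and $(\cdot\mid\cdot)$ satisfies the following condition: there exists a non-decreasing function $\rho_4:\mathbb{R}_{\geq 0}\to\mathbb{R}_{\geq 0}$ such that for every $R\geq 0$ and every $x\in X\setminus \overline{B}_d(x_0,\rho_4(R))$ there exists $y\in\overline{B}_d(x_0,\rho_4(R))$ satisfying $(x\mid y)\geq R$, where $\overline{B}_d(x_0,r)=\{y\in X: d(x_0,y)\leq r\}$.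
   Context: A metric space is proper if every closed bounded subset is compact. $\mathbb{R}_{\geq 0}$ is the set of non-negative reals and $\mathbb{N}$ the set of positive integers. Pre-controlled product. For a metric space $(X,d)$ and $x_0\in X$, a symmetric function $(\cdot\mid\cdot):X\times X\to\mathbb{R}_{\geq 0}$ is a pre-controlled product on $X$ (at $x_0$) if: (CP1) there is a non-decreasing $\rho_1:\mathbb{R}_{\geq 0}\to\mathbb{R}_{\geq 0}$ with $\min\{(x\mid y),(y\mid z)\}\leq\rho_1((x\mid z))$ for all $x,y,z\in X$; (CP2) there is a non-decreasing $\rho_2:\mathbb{R}_{\geq 0}\to\mathbb{R}_{\geq 0}$ with $(x\mid y)\leq\rho_2(d(x_0,x))$ for all $x,y\in X$; (CP3) there is a function $\rho_3:\mathbb{R}_{\geq 0}\times\mathbb{R}_{\geq 0}\to\mathbb{R}_{\geq 0}$, non-decreasing in the sense that $\rho_3(s_1,t_1)\leq\rho_3(s_2,t_2)$ whenever $s_1\leq s_2$ and $t_1\leq t_2$, with $d(x_0,x)\leq\rho_3((x\mid y),d(x,y))$ for all $x,y\in X$. Gromov boundary. $S_\infty(X)$ is the set of sequences $(x_i)$ in $X$ with $(x_i\mid x_j)\to\infty$ as $i,j\to\infty$. For $(x_i),(y_i)\in S_\infty(X)$ put $(x_i)\sim(y_i)$ iff $(x_i\mid y_i)\to\infty$ as $i\to\infty$; this is an equivalence relation. Set $\partial X=S_\infty(X)/\sim$ and $\overline{X}=X\cup\partial X$ (disjoint union). For $x\in X$ and a sequence $(x_i)$ in $X$, write $(x_i)\in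 x$ if $x_i=x$ for all $i$; for $x\in\partial X$, $(x_i)\in x$ means $(x_i)$ belongs to the class $x$. Extend the product to $\overline{X}\times\overline{X}\to\mathbb{R}_{\geq 0}\cup\{\infty\}$ by $(x\mid y)=\inf\{\liminf_{i\to\infty}(x_i\mid y_i):(x_i)\in x,\ (y_i)\in y\}$. Topology. For $n\in\mathbb{N}$ let $V_n=\{(x,y)\in\overline{X}\times\overline{X}:(x\mid y)>n\}\cup\{(x,y)\in X\times X:d(x,y)<1/n\}$. The family $\{V_n:n\in\mathbb{N}\}$ is a base of a metrizable uniformity on $\overline{X}$, and $\overline{X}$ carries the induced topology: the sets $V_n[x]=\{y\in\overline{X}:(y,x)\in V_n\}$, $n\in\mathbb{N}$, form a neighbourhood base at $x\in\overline{X}$. *)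

theory Defs
  imports "HOL-Analysis.Analysis"
begin

text \<open>
  Throughout, the metric space \<open>(X, d)\<close> is a type of class \<^class>\<open>metric_space\<close> with
  its \<^const>\<open>dist\<close>, and the product \<open>(x | y)\<close> is written \<open>cp x y\<close>. The half-line
  of non-negative reals is the set \<open>{0..}\<close>; control functions are total functions on
  the reals that are only constrained there.
\<close>

definition control_fun :: "(real \<Rightarrow> real) \<Rightarrow> bool" where
  "control_fun \<rho> \<longleftrightarrow> \<rho> \<in> {0..} \<rightarrow> {0..} \<and> mono_on {0..} \<rho>"

definition control_fun2 :: "(real \<Rightarrow> real \<Rightarrow> real) \<Rightarrow> bool" where
  "control_fun2 \<rho> \<longleftrightarrow>
     (\<forall>s\<ge>0. \<forall>t\<ge>0. \<rho> s t \<ge> 0) \<and>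
     (\<forall>s1 s2 t1 t2. 0 \<le> s1 \<and> s1 \<le> s2 \<and> 0 \<le> t1 \<and> t1 \<le> t2 \<longrightarrow> \<rho> s1 t1 \<le> \<rho> s2 t2)"

locale pre_controlled_product =
  fixes x0 :: "'a :: metric_space" and cp :: "'a \<Rightarrow> 'a \<Rightarrow> real"
  assumes nonneg: "0 \<le> cp x y"
    and sym: "cp x y = cp y x"
    and CP1: "\<exists>\<rho>1. control_fun \<rho>1 \<and> (\<forall>x y z. min (cp x y) (cp y z) \<le> \<rho>1 (cp x z))"
    and CP2: "\<exists>\<rho>2. control_fun \<rho>2 \<and> (\<forall>x y. cp x y \<le> \<rho>2 (dist x0 x))"
    and CP3: "\<exists>\<rho>3. control_fun2 \<rho>3 \<and> (\<forall>x y. dist x0 x \<le> \<rho>3 (cp x y) (dist x y))"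

definition S_infinity :: "('a \<Rightarrow> 'a \<Rightarrow> real) \<Rightarrow> (nat \<Rightarrow> 'a) set" where
  "S_infinity cp =
     {u. filterlim (\<lambda>(i, j). cp (u i) (u j)) at_top (sequentially \<times>\<^sub>F sequentially)}"

definition S_infinity_rel :: "('a \<Rightarrow> 'a \<Rightarrow> real) \<Rightarrow> ((nat \<Rightarrow> 'a) \<times> (nat \<Rightarrow> 'a)) set" where
  "S_infinity_rel cp =
     {(u, v) \<in> S_infinity cp \<times> S_infinity cp.
        filterlim (\<lambda>i. cp (u i) (v i)) at_top sequentially}"

definition gromov_boundary :: "('a \<Rightarrow> 'a \<Rightarrow> real) \<Rightarrow> (nat \<Rightarrow> 'a) set set" where
  "gromov_boundary cp = S_infinity cp // S_infinity_rel cp"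

definition gromov_closure :: "('a \<Rightarrow> 'a \<Rightarrow> real) \<Rightarrow> ('a + (nat \<Rightarrow> 'a) set) set" where
  "gromov_closure cp = UNIV <+> gromov_boundary cp"

text \<open>The sequences \<open>u\<close> with \<open>u \<in> x\<close>, for a point \<open>x\<close> of the closure.\<close>

fun point_seqs :: "'a + (nat \<Rightarrow> 'a) set \<Rightarrow> (nat \<Rightarrow> 'a) set" where
  "point_seqs (Inl x) = {\<lambda>_. x}"
| "point_seqs (Inr c) = c"

definition ext_product ::
  "('a \<Rightarrow> 'a \<Rightarrow> real) \<Rightarrow> 'a + (nat \<Rightarrow> 'a) set \<Rightarrow> 'a + (nat \<Rightarrow> 'a) set \<Rightarrow> ereal" where
  "ext_product cp a b =
     Inf {liminf (\<lambda>i. ereal (cp (u i) (v i))) | u v. u \<in> point_seqs a \<and> v \<in> point_seqs b}"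

text \<open>The entourage \<open>V\<^sub>n\<close>; only the indices \<open>n > 0\<close> belong to the base.\<close>

definition gromov_entourage ::
  "('a :: metric_space \<Rightarrow> 'a \<Rightarrow> real) \<Rightarrow> nat \<Rightarrow>
     (('a + (nat \<Rightarrow> 'a) set) \<times> ('a + (nat \<Rightarrow> 'a) set)) set" where
  "gromov_entourage cp n =
     {(a, b) \<in> gromov_closure cp \<times> gromov_closure cp. ext_product cp a b > ereal (real n)} \<union>
     {(Inl x, Inl y) | x y. dist x y < 1 / real n}"

definition gromov_nbhd ::
  "('a :: metric_space \<Rightarrow> 'a \<Rightarrow> real) \<Rightarrow> nat \<Rightarrow> 'a + (nat \<Rightarrow> 'a) set \<Rightarrow>
     ('a + (nat \<Rightarrow> 'a) set) set" where
  "gromov_nbhd cp n a = {b \<in> gromov_closure cp. (b, a) \<in> gromov_entourage cp n}"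

text \<open>The topology induced by the uniformity with base \<open>V\<^sub>n\<close>, \<open>n > 0\<close>.\<close>

definition gromov_topology ::
  "('a :: metric_space \<Rightarrow> 'a \<Rightarrow> real) \<Rightarrow> ('a + (nat \<Rightarrow> 'a) set) topology" where
  "gromov_topology cp =
     topology (\<lambda>U. U \<subseteq> gromov_closure cp \<and> (\<forall>a\<in>U. \<exists>n>0. gromov_nbhd cp n a \<subseteq> U))"

lemma gromov_nbhd_antimono:
  assumes "0 < m" "m \<le> n"
  shows "gromov_nbhd cp n a \<subseteq> gromov_nbhd cp m a"
proof -
  have "ereal (real m) < e" if "ereal (real n) < e" for e
    using that assms by (meson ereal_less_eq(3) of_nat_le_iff order_le_less_trans)
  moreover have "t < 1 / real m" if "t < 1 / real n" for t
    using that assms frac_le[of 1 1 "real m" "real n"] by simp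
  ultimately show ?thesis
    unfolding gromov_nbhd_def gromov_entourage_def by blast
qed

lemma openin_gromov_topology:
  "openin (gromov_topology cp) U \<longleftrightarrow>
     U \<subseteq> gromov_closure cp \<and> (\<forall>a\<in>U. \<exists>n>0. gromov_nbhd cp n a \<subseteq> U)"
proof -
  let ?L = "\<lambda>U. U \<subseteq> gromov_closure cp \<and> (\<forall>a\<in>U. \<exists>n>0. gromov_nbhd cp n a \<subseteq> U)"
  have "?L (S \<inter> T)" if S: "?L S" and T: "?L T" for S T
  proof (intro conjI ballI)
    show "S \<inter> T \<subseteq> gromov_closure cp" using S by blast
    fix a assume "a \<in> S \<inter> T"
    then obtain m n where mn: "m > 0" "gromov_nbhd cp m a \<subseteq> S" "n > 0" "gromov_nbhd cp n a \<subseteq> T"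
      using S T by blast
    have "gromov_nbhd cp (max m n) a \<subseteq> gromov_nbhd cp m a"
      "gromov_nbhd cp (max m n) a \<subseteq> gromov_nbhd cp n a"
      using mn by (simp_all add: gromov_nbhd_antimono)
    then have "gromov_nbhd cp (max m n) a \<subseteq> S \<inter> T" using mn by blast
    then show "\<exists>n>0. gromov_nbhd cp n a \<subseteq> S \<inter> T"
      using mn by (intro exI[of _ "max m n"]) simp
  qed
  moreover have "?L (\<Union>K)" if "\<forall>S\<in>K. ?L S" for K
    using that by (meson Sup_least UnionE Union_upper order_trans)
  ultimately have "istopology ?L"
    unfolding istopology_def by presburger
  then show ?thesis
    unfolding gromov_topology_def by simp
qed

lemma topspace_gromov_topology: "topspace (gromov_topology cp) = gromov_closure cp"
proof -
  have "openin (gromov_topology cp) (gromov_closure cp)"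
    unfolding openin_gromov_topology by (auto simp: gromov_nbhd_def)
  then show ?thesis
    by (metis openin_gromov_topology openin_subset openin_topspace subset_antisym)
qed

end

theory Submission
  imports Defs
begin

text \<open>
  Compactness of the closure is played off against total boundedness of the uniformity. If the
  closure is compact, finitely many \<open>V\<^sub>n\<close>-balls cover it; moving boundary centres slightly into
  \<open>X\<close> yields finitely many points of \<open>X\<close>, and their largest distance from \<open>x0\<close> gives \<open>\<rho>4\<close>.
  Conversely, properness and the condition on \<open>\<rho>4\<close> provide finite nets consisting of points
  of \<open>X\<close>. A cover without finite subcover then produces a decreasing sequence of
  \<open>V\<^sub>n\<close>-small sets without finite subcover, whose centres form a Cauchy sequence in \<open>X\<close>.
  That sequence either has a bounded subsequence and converges in \<open>X\<close>, or tends to infinity and,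
  by CP3, represents a boundary point; in both cases a single member of the cover contains
  one of the small sets.
\<close>

section \<open>Representing sequences and bounds for the extended product\<close>

lemma S_infinity_iff:
  "u \<in> S_infinity cp \<longleftrightarrow> (\<forall>K. \<exists>N. \<forall>i\<ge>N. \<forall>j\<ge>N. cp (u i) (u j) > K)"
  unfolding S_infinity_def filterlim_at_top_dense mem_Collect_eq
  by (simp add: eventually_prod_sequentially case_prod_unfold) blast

lemma S_infinity_rel_iff:
  "(u, v) \<in> S_infinity_rel cp \<longleftrightarrow>
     u \<in> S_infinity cp \<and> v \<in> S_infinity cp \<and>
     (\<forall>K. \<forall>\<^sub>F i in sequentially. cp (u i) (v i) > K)"
  unfolding S_infinity_rel_def filterlim_at_top_dense by auto

lemma ext_product_gtD:
  assumes "ext_product cp a b > ereal K" "u \<in> point_seqs a" "v \<in> point_seqs b"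
  shows "\<forall>\<^sub>F i in sequentially. cp (u i) (v i) > K"
proof -
  have "ext_product cp a b \<le> liminf (\<lambda>i. ereal (cp (u i) (v i)))"
    unfolding ext_product_def by (rule Inf_lower) (use assms in blast)
  then have "ereal K < liminf (\<lambda>i. ereal (cp (u i) (v i)))"
    using assms(1) by order
  from less_LiminfD[OF this] show ?thesis by simp
qed

text \<open>A bound that holds eventually along each pair of sequences becomes non-strict under
  liminf and infimum. The slack of 1 restores strictness.\<close>

lemma ext_product_gtI:
  assumes "\<And>u v. u \<in> point_seqs a \<Longrightarrow> v \<in> point_seqs b \<Longrightarrow>
      \<forall>\<^sub>F i in sequentially. cp (u i) (v i) > K + 1"
  shows "ext_product cp a b > ereal K"
proof -
  have "ereal (K + 1) \<le> ext_product cp a b"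
    unfolding ext_product_def
  proof (rule Inf_greatest, clarify)
    fix u v assume "u \<in> point_seqs a" "v \<in> point_seqs b"
    from assms[OF this] show "ereal (K + 1) \<le> liminf (\<lambda>i. ereal (cp (u i) (v i)))"
      by (intro Liminf_bounded) (auto elim: eventually_mono)
  qed
  then show ?thesis
    by (rule less_le_trans[rotated]) simp
qed

lemma ext_product_Inl [simp]: "ext_product cp (Inl x) (Inl y) = ereal (cp x y)"
  unfolding ext_product_def by (simp add: Liminf_const)

lemma Inl_in_gromov_closure [simp]: "Inl x \<in> gromov_closure cp"
  unfolding gromov_closure_def by (rule InlI) simp

section \<open>Threshold forms of the control axioms, and equivalence of sequences\<close>

context pre_controlled_product
begin

text \<open>Contrapositive of CP1 with the threshold \<open>\<rho>1 (max K 0)\<close>; the maximum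
  keeps the argument in the half-line where \<open>\<rho>1\<close> is controlled. Later arguments
  use CP1, CP2 and CP3 only through such thresholds, so no control functions have to be
  composed.\<close>

lemma product_trans: "\<exists>L. \<forall>x y z. cp x y > L \<and> cp y z > L \<longrightarrow> cp x z > K"
proof -
  obtain \<rho>1 where \<rho>: "control_fun \<rho>1" "\<And>x y z. min (cp x y) (cp y z) \<le> \<rho>1 (cp x z)"
    using CP1 by blast
  have "cp x z > K" if "cp x y > \<rho>1 (max K 0)" "cp y z > \<rho>1 (max K 0)" for x y z
  proof (rule ccontr)
    assume "\<not> cp x z > K"
    then have "\<rho>1 (cp x z) \<le> \<rho>1 (max K 0)"
      using \<rho>(1) nonneg[of x z] unfolding control_fun_def by (intro mono_onD[of "{0..}" \<rho>1]) auto
    with \<rho>(2)[of x y z] that show False by linarith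
  qed
  then show ?thesis by blast
qed

text \<open>CP2 by contraposition. It will separate bounded subsets of \<open>X\<close> from the
  boundary.\<close>

lemma dist_base_large: "\<exists>L. \<forall>x y. cp x y > L \<longrightarrow> dist x0 x > D"
proof -
  obtain \<rho>2 where \<rho>: "control_fun \<rho>2" "\<And>x y. cp x y \<le> \<rho>2 (dist x0 x)"
    using CP2 by blast
  have "dist x0 x > D" if "cp x y > \<rho>2 (max D 0)" for x y
  proof (rule ccontr)
    assume "\<not> dist x0 x > D"
    then have "\<rho>2 (dist x0 x) \<le> \<rho>2 (max D 0)"
      using \<rho>(1) unfolding control_fun_def by (intro mono_onD[of "{0..}" \<rho>2]) auto
    with \<rho>(2)[of x y] that show False by linarith
  qed
  then show ?thesis by blast
qed

text \<open>CP3 by contraposition, with \<open>\<rho>3\<close> evaluated at distance 1. This links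
  the two halves of an entourage: far from \<open>x0\<close>, metric closeness turns into a large
  product.\<close>

lemma product_large: "\<exists>L. \<forall>x y. dist x0 x > L \<and> dist x y \<le> 1 \<longrightarrow> cp x y > K"
proof -
  obtain \<rho>3 where \<rho>: "control_fun2 \<rho>3" "\<And>x y. dist x0 x \<le> \<rho>3 (cp x y) (dist x y)"
    using CP3 by blast
  have "cp x y > K" if "dist x0 x > \<rho>3 (max K 0) 1" "dist x y \<le> 1" for x y
  proof (rule ccontr)
    assume "\<not> cp x y > K"
    then have "\<rho>3 (cp x y) (dist x y) \<le> \<rho>3 (max K 0) 1"
      using \<rho>(1) nonneg[of x y] that(2) unfolding control_fun2_def by auto
    with \<rho>(2)[of x y] that show False by linarith
  qed
  then show ?thesis by blast
qed

text \<open>Reflexivity is the diagonal of the double limit, and transitivity is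
  \<open>product_trans\<close> applied term by term.\<close>

lemma equiv_S_infinity_rel: "equiv (S_infinity cp) (S_infinity_rel cp)"
proof (rule equivI)
  show "S_infinity_rel cp \<subseteq> S_infinity cp \<times> S_infinity cp"
    by (auto simp: S_infinity_rel_def)
  show "refl_on (S_infinity cp) (S_infinity_rel cp)"
  proof (rule refl_onI)
    fix u assume u: "u \<in> S_infinity cp"
    then show "(u, u) \<in> S_infinity_rel cp"
      unfolding S_infinity_rel_iff eventually_sequentially using S_infinity_iff[of u cp] by blast
  qed
  show "sym (S_infinity_rel cp)"
    by (rule symI) (simp add: S_infinity_rel_iff sym)
  show "trans (S_infinity_rel cp)"
  proof (rule transI)
    fix u v w assume uv: "(u, v) \<in> S_infinity_rel cp" and vw: "(v, w) \<in> S_infinity_rel cp"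
    have "\<forall>\<^sub>F i in sequentially. cp (u i) (w i) > K" for K
    proof -
      obtain L where L: "\<And>x y z. cp x y > L \<Longrightarrow> cp y z > L \<Longrightarrow> cp x z > K"
        using product_trans by blast
      have "\<forall>\<^sub>F i in sequentially. cp (u i) (v i) > L" "\<forall>\<^sub>F i in sequentially. cp (v i) (w i) > L"
        using uv vw by (simp_all add: S_infinity_rel_iff)
      then show ?thesis by eventually_elim (rule L)
    qed
    with uv vw show "(u, w) \<in> S_infinity_rel cp"
      by (simp add: S_infinity_rel_iff)
  qed
qed

lemma point_seqs_nonempty:
  assumes "a \<in> gromov_closure cp"
  obtains u where "u \<in> point_seqs a"
proof (cases a)
  case (Inr c)
  then have "c \<in> S_infinity cp // S_infinity_rel cp"
    using assms by (auto simp: gromov_closure_def gromov_boundary_def)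
  then have "c \<noteq> {}"
    using in_quotient_imp_non_empty equiv_S_infinity_rel by blast
  with Inr that show ?thesis by auto
qed (use that in auto)

lemma boundary_in_rel:
  assumes "Inr c \<in> gromov_closure cp" "u \<in> c" "v \<in> c"
  shows "(u, v) \<in> S_infinity_rel cp"
  using assms in_quotient_imp_in_rel[OF equiv_S_infinity_rel, of c u v]
  by (auto simp: gromov_closure_def gromov_boundary_def)

section \<open>The extended product on the closure\<close>

lemma ext_product_commute: "ext_product cp a b = ext_product cp b a"
proof (rule antisym)
  show "ext_product cp a b \<le> ext_product cp b a" for a b
    unfolding ext_product_def
  proof (rule Inf_greatest, clarify)
    fix v u assume "v \<in> point_seqs b" "u \<in> point_seqs a"
    moreover have "(\<lambda>i. ereal (cp (v i) (u i))) = (\<lambda>i. ereal (cp (u i) (v i)))"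
      by (rule ext) (simp add: sym)
    ultimately show "Inf {liminf (\<lambda>i. ereal (cp (u i) (v i))) |u v. u \<in> point_seqs a \<and> v \<in> point_seqs b}
        \<le> liminf (\<lambda>i. ereal (cp (v i) (u i)))"
      by (intro Inf_lower CollectI exI[of _ u] exI[of _ v]) simp
  qed
  then show "ext_product cp b a \<le> ext_product cp a b" .
qed

text \<open>One representative of the middle point \<open>b\<close> suffices to chain the two bounds
  term by term; membership in the closure guarantees that it exists.\<close>

lemma ext_product_trans:
  "\<exists>L. \<forall>a b c. b \<in> gromov_closure cp \<and> ext_product cp a b > ereal L \<and> ext_product cp b c > ereal L
     \<longrightarrow> ext_product cp a c > ereal K"
proof -
  obtain L where L: "\<And>x y z. cp x y > L \<Longrightarrow> cp y z > L \<Longrightarrow> cp x z > K + 1"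
    using product_trans by blast
  have "ext_product cp a c > ereal K"
    if b: "b \<in> gromov_closure cp" and ab: "ext_product cp a b > ereal L"
      and bc: "ext_product cp b c > ereal L" for a b c
  proof (rule ext_product_gtI)
    fix u w assume u: "u \<in> point_seqs a" and w: "w \<in> point_seqs c"
    obtain v where v: "v \<in> point_seqs b" using b point_seqs_nonempty by blast
    show "\<forall>\<^sub>F i in sequentially. cp (u i) (w i) > K + 1"
      using ext_product_gtD[OF ab u v] ext_product_gtD[OF bc v w] by eventually_elim (rule L)
  qed
  then show ?thesis by blast
qed

lemma ext_product_dist_base_large:
  "\<exists>L. \<forall>a x. a \<in> gromov_closure cp \<and> ext_product cp a (Inl x) > ereal L \<longrightarrow> dist x0 x > D"
proof -
  obtain L where L: "\<And>x y. cp x y > L \<Longrightarrow> dist x0 x > D"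
    using dist_base_large by blast
  have "dist x0 x > D" if a: "a \<in> gromov_closure cp" and ax: "ext_product cp a (Inl x) > ereal L" for a x
  proof -
    obtain u where "u \<in> point_seqs a" using a point_seqs_nonempty by blast
    then have "\<forall>\<^sub>F i in sequentially. cp (u i) x > L"
      using ext_product_gtD[OF ax, of u "\<lambda>_. x"] by simp
    then obtain i where "cp (u i) x > L"
      using eventually_happens' sequentially_bot by blast
    then show ?thesis using L sym by metis
  qed
  then show ?thesis by blast
qed

text \<open>Late terms of \<open>u\<close> have large products with each other, and
  \<open>u j\<close> eventually has a large product with \<open>v j\<close> for every representative
  \<open>v\<close>; chaining through \<open>u j\<close> bounds \<open>cp (u i) (v j)\<close>. The
  index \<open>N\<close> depends on \<open>u\<close> alone, hence serves all \<open>v\<close> at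
  once. This is how points of \<open>X\<close> approximate a boundary point.\<close>

lemma ext_product_boundary_large:
  assumes "Inr c \<in> gromov_closure cp" "u \<in> c"
  shows "\<forall>\<^sub>F i in sequentially. ext_product cp (Inl (u i)) (Inr c) > ereal K"
proof -
  obtain L where L: "\<And>x y z. cp x y > L \<Longrightarrow> cp y z > L \<Longrightarrow> cp x z > K + 1"
    using product_trans by blast
  have "u \<in> S_infinity cp"
    using boundary_in_rel[OF assms(1) assms(2) assms(2)] by (simp add: S_infinity_rel_iff)
  then obtain N where N: "\<And>i j. i \<ge> N \<Longrightarrow> j \<ge> N \<Longrightarrow> cp (u i) (u j) > L"
    unfolding S_infinity_iff by blast
  have "ext_product cp (Inl (u i)) (Inr c) > ereal K" if i: "i \<ge> N" for i
  proof (rule ext_product_gtI)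
    fix w v assume w: "w \<in> point_seqs (Inl (u i))" and v: "v \<in> point_seqs (Inr c)"
    have "\<forall>\<^sub>F j in sequentially. cp (u j) (v j) > L"
      using boundary_in_rel[OF assms(1) assms(2), of v] v by (simp add: S_infinity_rel_iff)
    moreover have "\<forall>\<^sub>F j in sequentially. j \<ge> N" by (rule eventually_ge_at_top)
    ultimately have "\<forall>\<^sub>F j in sequentially. cp (u i) (v j) > K + 1"
      by eventually_elim (use L N i in blast)
    then show "\<forall>\<^sub>F j in sequentially. cp (w j) (v j) > K + 1" using w by simp
  qed
  then show ?thesis unfolding eventually_sequentially by blast
qed

section \<open>Entourages and the induced neighbourhoods\<close>

lemma entourage_product:
  "\<lbrakk>a \<in> gromov_closure cp; b \<in> gromov_closure cp; ext_product cp a b > ereal (real n)\<rbrakk>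
    \<Longrightarrow> (a, b) \<in> gromov_entourage cp n"
  unfolding gromov_entourage_def by blast

lemma entourage_dist: "dist x y < 1 / real n \<Longrightarrow> (Inl x, Inl y) \<in> gromov_entourage cp n"
  unfolding gromov_entourage_def by blast

lemma entourage_cases:
  assumes "(a, b) \<in> gromov_entourage cp n"
  obtains (product) "ext_product cp a b > ereal (real n)"
  | (dist) x y where "a = Inl x" "b = Inl y" "dist x y < 1 / real n"
  using assms unfolding gromov_entourage_def by blast

lemma entourage_closure:
  assumes "(a, b) \<in> gromov_entourage cp n"
  shows "a \<in> gromov_closure cp" "b \<in> gromov_closure cp"
  using assms unfolding gromov_entourage_def by auto

lemma entourage_commute: "(a, b) \<in> gromov_entourage cp n \<longleftrightarrow> (b, a) \<in> gromov_entourage cp n"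
  unfolding gromov_entourage_def by (auto simp: dist_commute ext_product_commute)

lemma gromov_nbhd_iff: "b \<in> gromov_nbhd cp n a \<longleftrightarrow> (b, a) \<in> gromov_entourage cp n"
  unfolding gromov_nbhd_def using entourage_closure by blast

lemma entourage_antimono:
  "0 < m \<Longrightarrow> m \<le> n \<Longrightarrow> (a, b) \<in> gromov_entourage cp n \<Longrightarrow> (a, b) \<in> gromov_entourage cp m"
  using gromov_nbhd_antimono[of m n cp b] gromov_nbhd_iff by blast

lemma entourage_refl:
  assumes "n > 0" "a \<in> gromov_closure cp"
  shows "(a, a) \<in> gromov_entourage cp n"
proof (cases a)
  case (Inr c)
  have "ext_product cp a a > ereal (real n)"
  proof (rule ext_product_gtI)
    fix u v assume "u \<in> point_seqs a" "v \<in> point_seqs a"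
    then show "\<forall>\<^sub>F i in sequentially. cp (u i) (v i) > real n + 1"
      using boundary_in_rel[of c u v] assms(2) Inr by (simp add: S_infinity_rel_iff)
  qed
  then show ?thesis using assms by (simp add: entourage_product)
qed (use assms in \<open>simp add: entourage_dist\<close>)

text \<open>Composition axiom of the uniformity. Two product steps are chained by
  \<open>ext_product_trans\<close> and two metric steps by the triangle inequality; in the mixed
  case the metric step is first converted into a product step.\<close>

lemma entourage_comp:
  assumes "m > 0"
  obtains n where "n \<ge> m" "gromov_entourage cp n O gromov_entourage cp n \<subseteq> gromov_entourage cp m"
proof -
  obtain L1 where L1: "\<And>a b c. \<lbrakk>b \<in> gromov_closure cp; ext_product cp a b > ereal L1;
      ext_product cp b c > ereal L1\<rbrakk> \<Longrightarrow> ext_product cp a c > ereal (real m)"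
    using ext_product_trans by blast
  obtain L2 where L2: "\<And>x y. dist x0 x > L2 \<Longrightarrow> dist x y \<le> 1 \<Longrightarrow> cp x y > L1"
    using product_large by blast
  obtain L3 where L3: "\<And>a x. a \<in> gromov_closure cp \<Longrightarrow> ext_product cp a (Inl x) > ereal L3
      \<Longrightarrow> dist x0 x > L2"
    using ext_product_dist_base_large by blast
  \<comment> \<open>Beyond \<open>L1\<close> product steps chain, beyond \<open>L3\<close> the
    middle point of a mixed step is far from \<open>x0\<close>, and \<open>2 * real m\<close> halves
    the metric radius.\<close>
  obtain n :: nat where n: "real n \<ge> max (max L1 L3) (2 * real m)"
    using real_arch_simple by blast
  have large: "e > ereal L1" "e > ereal L3" if "e > ereal (real n)" for e
    using that n by (auto intro: order_le_less_trans[of _ "ereal (real n)"])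
  have half: "1 / real n \<le> 1 / real m / 2"
    using n assms frac_le[of 1 1 "2 * real m" "real n"] by simp
  have one: "1 / real n \<le> 1" using n assms by (simp add: field_simps)
  have mixed: "ext_product cp a (Inl z) > ereal (real m)"
    if a: "a \<in> gromov_closure cp" and ay: "ext_product cp a (Inl y) > ereal (real n)"
      and yz: "dist y z < 1 / real n" for a y z
  proof (rule L1)
    \<comment> \<open>The large product with \<open>a\<close> forces \<open>y\<close> far from
      \<open>x0\<close>, so its neighbour \<open>z\<close> has a large product with it.\<close>
    have "dist x0 y > L2" using L3 a ay large by blast
    then have "cp y z > L1" using L2 yz one by simp
    then show "ext_product cp (Inl y) (Inl z) > ereal L1" by simp
  qed (use ay large in auto)
  have "(a, c) \<in> gromov_entourage cp m"
    if ab: "(a, b) \<in> gromov_entourage cp n" and bc: "(b, c) \<in> gromov_entourage cp n" for a b c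
    using ab
  proof (cases rule: entourage_cases)
    case ab': product
    show ?thesis using bc
    proof (cases rule: entourage_cases)
      case product
      then have "ext_product cp a c > ereal (real m)"
        using L1 ab' large entourage_closure(1)[OF bc] by blast
      then show ?thesis
        using entourage_closure ab bc by (blast intro: entourage_product)
    next
      case (dist y z)
      then have "ext_product cp a c > ereal (real m)"
        using mixed ab' entourage_closure(1)[OF ab] by blast
      then show ?thesis
        using entourage_closure ab bc by (blast intro: entourage_product)
    qed
  next
    case ab': (dist x y)
    show ?thesis using bc
    proof (cases rule: entourage_cases)
      case product
      then have "ext_product cp c a > ereal (real m)"
        using mixed[of c y x] ab' entourage_closure(2)[OF bc]
        by (simp add: dist_commute ext_product_commute)
      then show ?thesis
        using entourage_product[OF entourage_closure(1)[OF ab] entourage_closure(2)[OF bc], of m]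
        by (simp add: ext_product_commute)
    next
      case (dist y' z)
      have "dist x z \<le> dist x y + dist y z" by (rule dist_triangle)
      then have "dist x z < 1 / real m" using dist ab' half by simp
      then show ?thesis using dist ab' by (simp add: entourage_dist)
    qed
  qed
  then have "gromov_entourage cp n O gromov_entourage cp n \<subseteq> gromov_entourage cp m"
    by blast
  moreover have "n \<ge> m" using n by simp
  ultimately show thesis using that by blast
qed

text \<open>The open set consists of the points owning some basic neighbourhood inside the given
  one; \<open>entourage_comp\<close> makes it open.\<close>

lemma gromov_nbhd_interior:
  assumes "a \<in> gromov_closure cp" "m > 0"
  obtains U where "openin (gromov_topology cp) U" "a \<in> U" "U \<subseteq> gromov_nbhd cp m a"
proof
  let ?U = "{b \<in> gromov_closure cp. \<exists>n>0. gromov_nbhd cp n b \<subseteq> gromov_nbhd cp m a}"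
  show "openin (gromov_topology cp) ?U"
    unfolding openin_gromov_topology
  proof (intro conjI ballI)
    fix b assume "b \<in> ?U"
    then obtain n where n: "n > 0" "gromov_nbhd cp n b \<subseteq> gromov_nbhd cp m a" by blast
    obtain k where k: "k \<ge> n" "gromov_entourage cp k O gromov_entourage cp k \<subseteq> gromov_entourage cp n"
      by (rule entourage_comp[OF n(1)])
    have "c \<in> ?U" if "c \<in> gromov_nbhd cp k b" for c
    proof -
      have "gromov_nbhd cp k c \<subseteq> gromov_nbhd cp n b"
      proof
        fix d assume "d \<in> gromov_nbhd cp k c"
        with that show "d \<in> gromov_nbhd cp n b"
          unfolding gromov_nbhd_iff by (blast intro: subsetD[OF k(2)])
      qed
      moreover have "c \<in> gromov_closure cp" using that by (simp add: gromov_nbhd_def)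
      ultimately show ?thesis using k(1) n by (auto intro!: exI[of _ k])
    qed
    then show "\<exists>n>0. gromov_nbhd cp n b \<subseteq> ?U"
      using k(1) n(1) by (intro exI[of _ k]) auto
  qed blast
  show "a \<in> ?U" using assms by blast
  show "?U \<subseteq> gromov_nbhd cp m a"
    using entourage_refl by (auto simp: gromov_nbhd_iff)
qed

section \<open>Consequences of compactness\<close>

text \<open>The open sets from \<open>gromov_nbhd_interior\<close> form the cover. At this stage the
  centres may be boundary points.\<close>

lemma compact_space_imp_finite_net:
  assumes "compact_space (gromov_topology cp)" "m > 0"
  obtains A where "finite A" "A \<subseteq> gromov_closure cp" "gromov_closure cp \<subseteq> (\<Union>a\<in>A. gromov_nbhd cp m a)"
proof -
  let ?P = "\<lambda>U a. openin (gromov_topology cp) U \<and> U \<subseteq> gromov_nbhd cp m a"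
  let ?C = "{U. \<exists>a\<in>gromov_closure cp. ?P U a}"
  have cover: "gromov_closure cp \<subseteq> \<Union>?C"
  proof
    fix a assume "a \<in> gromov_closure cp"
    with gromov_nbhd_interior[OF this assms(2)] show "a \<in> \<Union>?C" by blast
  qed
  have "\<exists>F. finite F \<and> F \<subseteq> ?C \<and> gromov_closure cp \<subseteq> \<Union>F"
  proof (rule compactinD)
    show "compactin (gromov_topology cp) (gromov_closure cp)"
      using assms(1) by (simp add: compact_space_def topspace_gromov_topology)
  qed (use cover in blast)+
  then obtain F where F: "finite F" "F \<subseteq> ?C" "gromov_closure cp \<subseteq> \<Union>F"
    by blast
  have "\<forall>U\<in>F. \<exists>a. a \<in> gromov_closure cp \<and> ?P U a" using F(2) by blast
  then obtain f where f: "\<And>U. U \<in> F \<Longrightarrow> f U \<in> gromov_closure cp \<and> ?P U (f U)" by metis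
  show thesis
  proof (rule that)
    show "finite (f ` F)" using F(1) by simp
    show "f ` F \<subseteq> gromov_closure cp" using f by blast
    show "gromov_closure cp \<subseteq> (\<Union>a\<in>f ` F. gromov_nbhd cp m a)"
    proof
      fix b assume "b \<in> gromov_closure cp"
      then obtain U where "U \<in> F" "b \<in> U" using F(3) by blast
      then show "b \<in> (\<Union>a\<in>f ` F. gromov_nbhd cp m a)" using f[of U] by blast
    qed
  qed
qed

text \<open>Around \<open>Inl x\<close> a sufficiently fine entourage admits only the metric
  alternative, because products with \<open>x\<close> are bounded in terms of
  \<open>dist x0 x\<close>.\<close>

lemma openin_Inl_image:
  assumes "open S"
  shows "openin (gromov_topology cp) (Inl ` S)"
  unfolding openin_gromov_topology
proof (intro conjI ballI)
  fix a assume "a \<in> (Inl ` S :: ('a + (nat \<Rightarrow> 'a) set) set)"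
  then obtain x where x: "a = Inl x" "x \<in> S" by blast
  then obtain e where e: "e > 0" "ball x e \<subseteq> S" using assms open_contains_ball by blast
  \<comment> \<open>The bound is taken at \<open>dist x0 x\<close> itself: for \<open>y = x\<close>
    the conclusion is absurd, which excludes the product alternative.\<close>
  obtain L where L: "\<And>b y. b \<in> gromov_closure cp \<Longrightarrow> ext_product cp b (Inl y) > ereal L
      \<Longrightarrow> dist x0 y > dist x0 x"
    using ext_product_dist_base_large by blast
  obtain n :: nat where n: "real n \<ge> max L (1 / e)" using real_arch_simple by blast
  have "real n > 0" using n e(1) by (smt (verit) divide_pos_pos)
  have "1 / real n \<le> e" using n e(1) \<open>real n > 0\<close> by (simp add: field_simps)
  have "b \<in> Inl ` S" if "b \<in> gromov_nbhd cp n a" for b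
  proof -
    have "(b, a) \<in> gromov_entourage cp n" using that gromov_nbhd_iff by blast
    then show ?thesis
    proof (cases rule: entourage_cases)
      case product
      then have "ext_product cp b (Inl x) > ereal L"
        using n x(1) by (auto intro: order_le_less_trans[of _ "ereal (real n)"])
      with L[of b x] that show ?thesis by (simp add: gromov_nbhd_def)
    next
      case (dist y z)
      then have "y \<in> ball x e" using x(1) \<open>1 / real n \<le> e\<close> by (simp add: dist_commute)
      then show ?thesis using e(2) dist by blast
    qed
  qed
  then show "\<exists>n>0. gromov_nbhd cp n a \<subseteq> Inl ` S"
    using \<open>real n > 0\<close> by (intro exI[of _ n]) auto
qed auto

text \<open>A boundary point is close to points of \<open>S\<close> only through large products,
  which boundedness of \<open>S\<close> forbids by CP2. Around points of \<open>X\<close>, openness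
  of the complement of \<open>S\<close> is enough.\<close>

lemma closedin_Inl_image:
  assumes "closed S" "bounded S"
  shows "closedin (gromov_topology cp) (Inl ` S)"
  unfolding closedin_def topspace_gromov_topology
proof
  obtain D where D: "\<And>x. x \<in> S \<Longrightarrow> dist x0 x \<le> D"
    using assms(2) bounded_any_center by metis
  obtain L where L: "\<And>b y. b \<in> gromov_closure cp \<Longrightarrow> ext_product cp b (Inl y) > ereal L
      \<Longrightarrow> dist x0 y > D"
    using ext_product_dist_base_large by blast
  show "openin (gromov_topology cp) (gromov_closure cp - Inl ` S)"
    unfolding openin_gromov_topology
  proof (intro conjI ballI)
    fix a assume a: "a \<in> gromov_closure cp - Inl ` S"
    show "\<exists>n>0. gromov_nbhd cp n a \<subseteq> gromov_closure cp - Inl ` S"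
    proof (cases a)
      case (Inl x)
      have "openin (gromov_topology cp) (Inl ` (- S))"
        using assms(1) by (intro openin_Inl_image) (simp add: open_Compl)
      moreover have "a \<in> Inl ` (- S)" using a Inl by auto
      ultimately obtain n where "n > 0" "gromov_nbhd cp n a \<subseteq> Inl ` (- S)"
        unfolding openin_gromov_topology by blast
      then show ?thesis by (intro exI[of _ n]) auto
    next
      case (Inr c)
      obtain n :: nat where n: "real n \<ge> max L 1" using real_arch_simple by blast
      have False if "y \<in> S" "Inl y \<in> gromov_nbhd cp n a" for y
      proof -
        have "(a, Inl y) \<in> gromov_entourage cp n" using that gromov_nbhd_iff entourage_commute by blast
        then have "ext_product cp a (Inl y) > ereal (real n)"
          by (cases rule: entourage_cases) (use Inr in auto)
        then have "ext_product cp a (Inl y) > ereal L"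
          using n by (auto intro: order_le_less_trans[of _ "ereal (real n)"])
        then show False using L[of a y] D[OF that(1)] a by auto
      qed
      moreover have "n > 0" using n by simp
      ultimately show ?thesis
        by (intro exI[of _ n]) (auto simp: gromov_nbhd_def)
    qed
  qed blast
qed auto

text \<open>The image of \<open>S\<close> under \<open>Inl\<close> is closed in a compact space,
  hence compact, and \<open>openin_Inl_image\<close> lets open covers of \<open>S\<close> be
  transported to it.\<close>

lemma compact_space_imp_proper:
  fixes S :: "'a set"
  assumes "compact_space (gromov_topology cp)" "closed S" "bounded S"
  shows "compact S"
proof (rule compactI)
  fix C assume C: "\<forall>T\<in>C. open T" "S \<subseteq> \<Union>C"
  let ?C = "(`) Inl ` C :: ('a + (nat \<Rightarrow> 'a) set) set set"
  have "\<exists>F. finite F \<and> F \<subseteq> ?C \<and> Inl ` S \<subseteq> \<Union>F"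
  proof (rule compactinD)
    show "compactin (gromov_topology cp) (Inl ` S)"
      using closedin_compact_space[OF assms(1) closedin_Inl_image[OF assms(2,3)]] .
    show "openin (gromov_topology cp) U" if "U \<in> ?C" for U
      using C(1) that openin_Inl_image by auto
    show "Inl ` S \<subseteq> \<Union>?C" using C(2) by blast
  qed
  then obtain F where F: "finite F" "F \<subseteq> ?C" "Inl ` S \<subseteq> \<Union>F"
    by blast
  from finite_subset_image[OF F(1,2)] obtain G where G: "G \<subseteq> C" "finite G" "F = (`) Inl ` G"
    by blast
  have "S \<subseteq> \<Union>G" using F(3) unfolding G(3) by auto
  with G show "\<exists>C'\<subseteq>C. finite C' \<and> S \<subseteq> \<Union>C'" by blast
qed

text \<open>Each net centre is replaced by a point \<open>f a\<close> of \<open>X\<close>: itself,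
  or a term of a representing sequence that is close to the boundary class. Every \<open>x\<close>
  near the centre then has product at least \<open>R\<close> with \<open>f a\<close> or lies within
  distance 1 of it.\<close>

lemma compact_space_imp_radius:
  assumes "compact_space (gromov_topology cp)"
  shows "\<exists>r\<ge>0. \<forall>x. x \<notin> cball x0 r \<longrightarrow> (\<exists>y\<in>cball x0 r. cp x y \<ge> R)"
proof -
  obtain L where L: "\<And>a b c. \<lbrakk>b \<in> gromov_closure cp; ext_product cp a b > ereal L;
      ext_product cp b c > ereal L\<rbrakk> \<Longrightarrow> ext_product cp a c > ereal R"
    using ext_product_trans by blast
  obtain n :: nat where n: "real n \<ge> max (max L R) 1" using real_arch_simple by blast
  have n0: "n > 0" and inv: "1 / real n \<le> 1" using n by (auto simp: field_simps)
  obtain A where A: "finite A" "A \<subseteq> gromov_closure cp" "gromov_closure cp \<subseteq> (\<Union>a\<in>A. gromov_nbhd cp n a)"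
    using compact_space_imp_finite_net[OF assms n0] by blast
  have "\<exists>y. \<forall>x. Inl x \<in> gromov_nbhd cp n a \<longrightarrow> cp x y \<ge> R \<or> dist x y \<le> 1" if "a \<in> A" for a
  proof (cases a)
    case (Inl y)
    have "cp x y \<ge> R \<or> dist x y \<le> 1" if "Inl x \<in> gromov_nbhd cp n a" for x
      using that unfolding gromov_nbhd_iff
    proof (cases rule: entourage_cases)
      case product
      then show ?thesis using Inl n by simp
    next
      case (dist x' y')
      then have "dist x y < 1 / real n" using Inl by simp
      then show ?thesis using inv by linarith
    qed
    then show ?thesis by blast
  next
    case (Inr c)
    have a: "Inr c \<in> gromov_closure cp" using Inr A(2) that by blast
    obtain u where u: "u \<in> c" using point_seqs_nonempty[OF a] by auto
    obtain i where i: "ext_product cp (Inl (u i)) (Inr c) > ereal L"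
      using eventually_happens'[OF sequentially_bot ext_product_boundary_large[OF a u]] by auto
    have "cp x (u i) \<ge> R" if "Inl x \<in> gromov_nbhd cp n a" for x
    proof -
      have "ext_product cp (Inl x) a > ereal (real n)"
        using that unfolding gromov_nbhd_iff
        by (cases rule: entourage_cases) (use Inr in auto)
      then have "ext_product cp (Inl x) a > ereal L"
        using n by (auto intro: order_le_less_trans[of _ "ereal (real n)"])
      then have "ext_product cp (Inl x) (Inl (u i)) > ereal R"
        using L[of a "Inl x" "Inl (u i)"] i a Inr by (metis ext_product_commute)
      then show ?thesis by simp
    qed
    then show ?thesis by blast
  qed
  then obtain f where f: "\<And>a x. a \<in> A \<Longrightarrow> Inl x \<in> gromov_nbhd cp n a \<Longrightarrow> cp x (f a) \<ge> R \<or> dist x (f a) \<le> 1"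
    by metis
  \<comment> \<open>The sum dominates every summand. The extra 1 keeps points outside the ball from
    lying within distance 1 of any \<open>f a\<close>.\<close>
  define r where "r = (\<Sum>a\<in>A. dist x0 (f a) + 1)"
  have r: "dist x0 (f a) + 1 \<le> r" if "a \<in> A" for a
    unfolding r_def by (rule member_le_sum) (use A(1) that in auto)
  have "\<exists>y\<in>cball x0 r. cp x y \<ge> R" if x: "x \<notin> cball x0 r" for x
  proof -
    obtain a where a: "a \<in> A" "Inl x \<in> gromov_nbhd cp n a"
      using A(3) Inl_in_gromov_closure[of x cp] by blast
    have "dist x0 x \<le> dist x0 (f a) + dist x (f a)"
      by (rule dist_triangle2)
    with x r[OF a(1)] have "\<not> dist x (f a) \<le> 1" by auto
    then show ?thesis using f[OF a] r[OF a(1)] by (intro bexI[of _ "f a"]) auto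
  qed
  moreover have "r \<ge> 0" unfolding r_def by (simp add: sum_nonneg)
  ultimately show ?thesis by blast
qed

text \<open>Radii chosen separately for each \<open>R\<close> need not be monotone. Summing those
  for the integers up to the ceiling of \<open>R\<close> gives a non-decreasing function, and
  rounding \<open>R\<close> up only strengthens the required bound.\<close>

lemma radius_imp_control_fun:
  assumes "\<And>R. \<exists>r\<ge>0. \<forall>x. x \<notin> cball x0 r \<longrightarrow> (\<exists>y\<in>cball x0 r. cp x y \<ge> R)"
  shows "\<exists>\<rho>4. control_fun \<rho>4 \<and>
    (\<forall>R\<ge>0. \<forall>x. x \<notin> cball x0 (\<rho>4 R) \<longrightarrow> (\<exists>y\<in>cball x0 (\<rho>4 R). cp x y \<ge> R))"
proof -
  have "\<exists>r. \<forall>R. r R \<ge> 0 \<and> (\<forall>x. x \<notin> cball x0 (r R) \<longrightarrow> (\<exists>y\<in>cball x0 (r R). cp x y \<ge> R))"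
    by (rule choice) (use assms in blast)
  then obtain r where r: "\<And>R. r R \<ge> 0"
    "\<And>R x. x \<notin> cball x0 (r R) \<Longrightarrow> \<exists>y\<in>cball x0 (r R). cp x y \<ge> R"
    by blast
  define \<rho> where "\<rho> R = (\<Sum>k\<le>nat \<lceil>R\<rceil>. r (real k))" for R :: real
  have "control_fun \<rho>"
    unfolding control_fun_def
  proof
    show "\<rho> \<in> {0..} \<rightarrow> {0..}" using r(1) by (intro Pi_I) (simp add: \<rho>_def sum_nonneg)
    show "mono_on {0..} \<rho>"
    proof (rule mono_onI)
      fix s t :: real assume "s \<le> t"
      then have "nat \<lceil>s\<rceil> \<le> nat \<lceil>t\<rceil>" by (intro nat_mono ceiling_mono)
      then show "\<rho> s \<le> \<rho> t"
        unfolding \<rho>_def using r(1) by (intro sum_mono2) auto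
    qed
  qed
  moreover have "\<exists>y\<in>cball x0 (\<rho> R). cp x y \<ge> R" if "R \<ge> 0" "x \<notin> cball x0 (\<rho> R)" for R x
  proof -
    let ?k = "real (nat \<lceil>R\<rceil>)"
    have "r ?k \<le> \<rho> R"
      unfolding \<rho>_def using r(1)
      by (intro member_le_sum[of "nat \<lceil>R\<rceil>" "{..nat \<lceil>R\<rceil>}" "\<lambda>k. r (real k)"]) auto
    \<comment> \<open>A point outside the large ball is outside the small one, and the partner found
      in the small ball also lies in the large one.\<close>
    then have sub: "cball x0 (r ?k) \<subseteq> cball x0 (\<rho> R)" by auto
    then obtain y where "y \<in> cball x0 (r ?k)" "cp x y \<ge> ?k" using r(2) \<open>x \<notin> _\<close> by blast
    moreover have "?k \<ge> R" by (rule real_nat_ceiling_ge)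
    ultimately show ?thesis using sub by (intro bexI[of _ y]) auto
  qed
  ultimately show ?thesis by blast
qed

section \<open>Finite nets and completeness\<close>

text \<open>A point of the closure reaches the net in three moves: to a point of \<open>X\<close>,
  from there into a fixed ball by the radius condition, and inside that compact ball to a point of a
  metric net. The last two moves are \<open>k\<close>-small and combine to an \<open>n\<close>-small
  one, which combines with the first.\<close>

lemma finite_net:
  assumes proper: "\<And>S :: 'a set. closed S \<Longrightarrow> bounded S \<Longrightarrow> compact S"
    and radius: "\<And>R. R \<ge> 0 \<Longrightarrow> \<exists>r. \<forall>x. x \<notin> cball x0 r \<longrightarrow> (\<exists>y\<in>cball x0 r. cp x y \<ge> R)"
    and "m > 0"
  obtains A where "finite A" "gromov_closure cp \<subseteq> (\<Union>x\<in>A. gromov_nbhd cp m (Inl x))"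
proof -
  obtain n where n: "n \<ge> m" "gromov_entourage cp n O gromov_entourage cp n \<subseteq> gromov_entourage cp m"
    by (rule entourage_comp[OF \<open>m > 0\<close>])
  have "n > 0" using n(1) \<open>m > 0\<close> by simp
  obtain k where k: "k \<ge> n" "gromov_entourage cp k O gromov_entourage cp k \<subseteq> gromov_entourage cp n"
    by (rule entourage_comp[OF \<open>n > 0\<close>])
  have pos: "k > 0" "n > 0" using k(1) \<open>n > 0\<close> by auto
  \<comment> \<open>The summand 1 turns the non-strict bound into the strict one that the entourage
    asks for.\<close>
  obtain r where r: "\<And>x. x \<notin> cball x0 r \<Longrightarrow> \<exists>y\<in>cball x0 r. cp x y \<ge> real k + 1"
    using radius[of "real k + 1"] by auto
  have "compact (cball x0 r)" by (rule proper) auto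
  then obtain A where A: "finite A" "cball x0 r \<subseteq> (\<Union>x\<in>A. ball x (1 / real k))"
    using seq_compact_imp_totally_bounded[OF compact_imp_seq_compact, THEN spec, of "cball x0 r" "1 / real k"] pos(1)
    by auto
  have X: "\<exists>y\<in>A. (Inl x, Inl y) \<in> gromov_entourage cp n" for x
  proof -
    have "\<exists>z\<in>cball x0 r. (Inl x, Inl z) \<in> gromov_entourage cp k"
    proof (cases "x \<in> cball x0 r")
      case True
      then show ?thesis using entourage_refl[OF pos(1), of "Inl x"] by auto
    next
      case False
      then obtain z where z: "z \<in> cball x0 r" "cp x z \<ge> real k + 1" using r by blast
      then have "(Inl x, Inl z) \<in> gromov_entourage cp k"
        by (intro entourage_product) auto
      with z show ?thesis by blast
    qed
    then obtain z where z: "z \<in> cball x0 r" "(Inl x, Inl z) \<in> gromov_entourage cp k" by blast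
    then obtain y where "y \<in> A" "dist z y < 1 / real k" using A(2) by (auto simp: dist_commute)
    then show ?thesis using subsetD[OF k(2) relcompI[OF z(2) entourage_dist]] by blast
  qed
  have "\<exists>x. (a, Inl x) \<in> gromov_entourage cp n" if a: "a \<in> gromov_closure cp" for a
  proof (cases a)
    case (Inl x)
    then show ?thesis using entourage_refl[OF pos(2) a] by auto
  next
    case (Inr c)
    obtain u where u: "u \<in> c" using point_seqs_nonempty[OF a] Inr by auto
    obtain i where "ext_product cp (Inl (u i)) (Inr c) > ereal (real n)"
      using eventually_happens'[OF sequentially_bot ext_product_boundary_large[of c u]] u a Inr by auto
    then have "(a, Inl (u i)) \<in> gromov_entourage cp n"
      using a Inr by (intro entourage_product) (auto simp: ext_product_commute)
    then show ?thesis by blast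
  qed
  then have "gromov_closure cp \<subseteq> (\<Union>x\<in>A. gromov_nbhd cp m (Inl x))"
    using X subsetD[OF n(2) relcompI] by (fastforce simp: gromov_nbhd_iff)
  with A(1) that show thesis by blast
qed

text \<open>Either some ball is visited infinitely often, properness yields a cluster point, and a
  Cauchy sequence converges to it; or the distances from \<open>x0\<close> tend to infinity, and the
  limit is the class of \<open>x\<close> itself.\<close>

lemma Cauchy_converges:
  assumes proper: "\<And>S :: 'a set. closed S \<Longrightarrow> bounded S \<Longrightarrow> compact S"
    and Cauchy: "\<And>m. m > 0 \<Longrightarrow> \<exists>N. \<forall>i\<ge>N. \<forall>j\<ge>N. (Inl (x i), Inl (x j)) \<in> gromov_entourage cp m"
  obtains a where "a \<in> gromov_closure cp"
    "\<And>m. m > 0 \<Longrightarrow> \<forall>\<^sub>F i in sequentially. (Inl (x i), a) \<in> gromov_entourage cp m"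
proof (cases "\<exists>D. \<exists>\<^sub>F i in sequentially. dist x0 (x i) \<le> D")
  case True
  then obtain D where "\<exists>\<^sub>F i in sequentially. dist x0 (x i) \<le> D" by blast
  then have inf: "infinite {i. dist x0 (x i) \<le> D}"
    by (simp add: frequently_cofinite cofinite_eq_sequentially[symmetric])
  define s where "s = enumerate {i. dist x0 (x i) \<le> D}"
  have s: "strict_mono s" "\<And>i. dist x0 (x (s i)) \<le> D"
    using strict_mono_enumerate[OF inf] enumerate_in_set[OF inf] by (auto simp: s_def)
  have "compact (cball x0 D)" by (rule proper) auto
  then obtain l t where t: "strict_mono t" "(\<lambda>i. x (s (t i))) \<longlonglongrightarrow> l"
    unfolding compact_def using s(2) by (force simp: o_def dest!: spec[of _ "x \<circ> s"])
  show thesis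
  proof (rule that[of "Inl l"])
    fix m :: nat assume "m > 0"
    obtain n where n: "n \<ge> m" "gromov_entourage cp n O gromov_entourage cp n \<subseteq> gromov_entourage cp m"
      by (rule entourage_comp[OF \<open>m > 0\<close>])
    have "n > 0" using n(1) \<open>m > 0\<close> by simp
    obtain N where N: "\<And>i j. i \<ge> N \<Longrightarrow> j \<ge> N \<Longrightarrow> (Inl (x i), Inl (x j)) \<in> gromov_entourage cp n"
      using Cauchy[OF \<open>n > 0\<close>] by blast
    have "\<forall>\<^sub>F i in sequentially. dist (x (s (t i))) l < 1 / real n"
      using t(2) \<open>n > 0\<close> by (intro tendstoD) auto
    moreover have "\<forall>\<^sub>F i in sequentially. i \<ge> N" by (rule eventually_ge_at_top)
    ultimately have "\<forall>\<^sub>F i in sequentially. i \<ge> N \<and> dist (x (s (t i))) l < 1 / real n"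
      by eventually_elim simp
    then obtain i where i: "i \<ge> N" "dist (x (s (t i))) l < 1 / real n"
      using eventually_happens'[OF sequentially_bot] by blast
    \<comment> \<open>Subsequence indices dominate their positions, so one and the same term lies in
      the Cauchy tail and close to \<open>l\<close>.\<close>
    have "s (t i) \<ge> N"
      using i(1) seq_suble[OF s(1), of "t i"] seq_suble[OF t(1), of i] by linarith
    then show "\<forall>\<^sub>F j in sequentially. (Inl (x j), Inl l) \<in> gromov_entourage cp m"
      unfolding eventually_sequentially
      using subsetD[OF n(2) relcompI[OF N entourage_dist[OF i(2)]]] by blast
  qed simp
next
  case False
  then have far: "\<forall>\<^sub>F i in sequentially. dist x0 (x i) > D" for D
    by (simp add: not_frequently not_le)
  \<comment> \<open>Far from \<open>x0\<close> both alternatives of an entourage give a large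
    product, the metric one by CP3.\<close>
  have "\<exists>N. \<forall>i\<ge>N. \<forall>j\<ge>N. cp (x i) (x j) > K" for K
  proof -
    obtain L where L: "\<And>y z. dist x0 y > L \<Longrightarrow> dist y z \<le> 1 \<Longrightarrow> cp y z > K"
      using product_large by blast
    obtain M where M: "\<And>i. i \<ge> M \<Longrightarrow> dist x0 (x i) > L"
      using far[of L] unfolding eventually_sequentially by blast
    obtain n :: nat where n: "real n \<ge> max K 1" using real_arch_simple by blast
    obtain N where N: "\<And>i j. i \<ge> N \<Longrightarrow> j \<ge> N \<Longrightarrow> (Inl (x i), Inl (x j)) \<in> gromov_entourage cp n"
      using Cauchy[of n] n by auto
    have "cp (x i) (x j) > K" if "i \<ge> max M N" "j \<ge> max M N" for i j
    proof -
      have "(Inl (x i), Inl (x j)) \<in> gromov_entourage cp n" using N that by simp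
      then show ?thesis
      proof (cases rule: entourage_cases)
        case product
        then show ?thesis using n by simp
      next
        case (dist y z)
        moreover have "1 / real n \<le> 1" using n by (simp add: field_simps)
        ultimately show ?thesis using L[OF M[of i], of "x j"] that by simp
      qed
    qed
    then show ?thesis by blast
  qed
  then have S: "x \<in> S_infinity cp" by (simp add: S_infinity_iff)
  define c where "c = S_infinity_rel cp `` {x}"
  have c: "Inr c \<in> gromov_closure cp"
    using S by (auto simp: c_def gromov_closure_def gromov_boundary_def intro: quotientI)
  have x: "x \<in> c"
    unfolding c_def using equiv_class_self[OF equiv_S_infinity_rel S] .
  show thesis
  proof (rule that[OF c])
    fix m :: nat
    show "\<forall>\<^sub>F i in sequentially. (Inl (x i), Inr c) \<in> gromov_entourage cp m"
      using ext_product_boundary_large[OF c x, of "real m"]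
      by eventually_elim (simp add: entourage_product c)
  qed
qed

text \<open>Total boundedness together with completeness gives compactness. Since the net centres
  lie in \<open>X\<close>, convergence of Cauchy sequences in \<open>X\<close> is all the
  completeness that is called upon.\<close>

lemma compact_space_if_finite_nets:
  assumes proper: "\<And>S :: 'a set. closed S \<Longrightarrow> bounded S \<Longrightarrow> compact S"
    and net: "\<And>m. m > 0 \<Longrightarrow>
      \<exists>A. finite A \<and> gromov_closure cp \<subseteq> (\<Union>x\<in>A. gromov_nbhd cp m (Inl x))"
  shows "compact_space (gromov_topology cp)"
  unfolding compact_space_alt topspace_gromov_topology
proof (intro allI impI, elim conjE, rule ccontr)
  fix C assume C: "\<forall>U\<in>C. openin (gromov_topology cp) U" "gromov_closure cp \<subseteq> \<Union>C"
  define bad where "bad B \<longleftrightarrow> B \<subseteq> gromov_closure cp \<and> \<not> (\<exists>F. finite F \<and> F \<subseteq> C \<and> B \<subseteq> \<Union>F)" for B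
  assume "\<not> (\<exists>F. finite F \<and> F \<subseteq> C \<and> gromov_closure cp \<subseteq> \<Union>F)"
  then have bad_top: "bad (gromov_closure cp)" by (simp add: bad_def)
  \<comment> \<open>If every piece of \<open>B\<close> cut out by the finite net had a finite
    subcover, their union would be one for \<open>B\<close>.\<close>
  have split: "\<exists>B'. (bad B' \<and> (\<exists>x. B' \<subseteq> gromov_nbhd cp m (Inl x))) \<and> B' \<subseteq> B"
    if "bad B" "m > 0" for B m
  proof (rule ccontr)
    assume none: "\<nexists>B'. (bad B' \<and> (\<exists>x. B' \<subseteq> gromov_nbhd cp m (Inl x))) \<and> B' \<subseteq> B"
    have B_sub: "B \<subseteq> gromov_closure cp" using \<open>bad B\<close> unfolding bad_def by blast
    obtain A where A: "finite A" "gromov_closure cp \<subseteq> (\<Union>x\<in>A. gromov_nbhd cp m (Inl x))"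
      using net \<open>m > 0\<close> by blast
    have "\<forall>x. \<exists>F. finite F \<and> F \<subseteq> C \<and> B \<inter> gromov_nbhd cp m (Inl x) \<subseteq> \<Union>F"
    proof
      fix x
      have "\<not> bad (B \<inter> gromov_nbhd cp m (Inl x))" using none by blast
      moreover have "B \<inter> gromov_nbhd cp m (Inl x) \<subseteq> gromov_closure cp" using B_sub by blast
      ultimately show "\<exists>F. finite F \<and> F \<subseteq> C \<and> B \<inter> gromov_nbhd cp m (Inl x) \<subseteq> \<Union>F"
        unfolding bad_def by argo
    qed
    from choice[OF this] obtain F where F: "\<And>x. finite (F x)" "\<And>x. F x \<subseteq> C"
      "\<And>x. B \<inter> gromov_nbhd cp m (Inl x) \<subseteq> \<Union>(F x)"
      by blast
    have "finite (\<Union>x\<in>A. F x)" using A(1) F(1) by simp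
    moreover have "(\<Union>x\<in>A. F x) \<subseteq> C" using F(2) by blast
    moreover have "B \<subseteq> \<Union>(\<Union>x\<in>A. F x)"
    proof
      fix b assume b: "b \<in> B"
      then obtain x where "x \<in> A" "b \<in> gromov_nbhd cp m (Inl x)"
        using A(2) B_sub by blast
      with F(3)[of x] b show "b \<in> \<Union>(\<Union>x\<in>A. F x)" by blast
    qed
    ultimately have "\<exists>F. finite F \<and> F \<subseteq> C \<and> B \<subseteq> \<Union>F" by (intro exI conjI)
    then show False using \<open>bad B\<close> unfolding bad_def by argo
  qed
  \<comment> \<open>The shift to \<open>Suc k\<close> starts the construction at index 1, as only
    positive indices belong to the base.\<close>
  let ?P = "\<lambda>k B. bad B \<and> (\<exists>x. B \<subseteq> gromov_nbhd cp (Suc k) (Inl x))"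
  have "\<exists>B. \<forall>k. ?P k (B k) \<and> B (Suc k) \<subseteq> B k"
  proof (rule dependent_nat_choice)
    show "\<exists>B. ?P 0 B" using split[OF bad_top, of "Suc 0"] by auto
    show "\<exists>B'. ?P (Suc k) B' \<and> B' \<subseteq> B" if "?P k B" for B k
      using split[of B "Suc (Suc k)"] that by blast
  qed
  then obtain B where B: "\<And>k. ?P k (B k)" "\<And>k. B (Suc k) \<subseteq> B k"
    by blast
  then obtain x where x: "\<And>k. B k \<subseteq> gromov_nbhd cp (Suc k) (Inl (x k))" by metis
  have B_anti: "B j \<subseteq> B i" if "i \<le> j" for i j
    using lift_Suc_antimono_le[of B, OF B(2) that] .
  have near: "(b, Inl (x i)) \<in> gromov_entourage cp n" if "b \<in> B i" "n \<le> Suc i" "n > 0" for b i n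
    using x[of i] that entourage_antimono[OF that(3,2)] gromov_nbhd_iff by blast
  have "\<exists>N. \<forall>i\<ge>N. \<forall>j\<ge>N. (Inl (x i), Inl (x j)) \<in> gromov_entourage cp m" if "m > 0" for m
  proof -
    obtain n where n: "n \<ge> m" "gromov_entourage cp n O gromov_entourage cp n \<subseteq> gromov_entourage cp m"
      by (rule entourage_comp[OF \<open>m > 0\<close>])
    have "(Inl (x i), Inl (x j)) \<in> gromov_entourage cp m" if ij: "i \<ge> n" "j \<ge> n" for i j
    proof -
      \<comment> \<open>The empty set is covered by the empty family, so bad sets are nonempty. A
        point of the smaller of the two nested sets is close to both centres.\<close>
      have "B (max i j) \<noteq> {}"
        using B(1)[of "max i j"] unfolding bad_def by blast
      then obtain b where "b \<in> B i" "b \<in> B j" using B_anti[of i "max i j"] B_anti[of j "max i j"] by auto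
      then have "(b, Inl (x i)) \<in> gromov_entourage cp n" "(b, Inl (x j)) \<in> gromov_entourage cp n"
        using near ij n(1) \<open>m > 0\<close> by auto
      then show ?thesis using subsetD[OF n(2) relcompI] entourage_commute by blast
    qed
    then show ?thesis by blast
  qed
  then obtain a where a: "a \<in> gromov_closure cp"
    "\<And>m. m > 0 \<Longrightarrow> \<forall>\<^sub>F i in sequentially. (Inl (x i), a) \<in> gromov_entourage cp m"
    using Cauchy_converges[OF proper, of x] by blast
  from a(1) obtain U where U: "U \<in> C" "a \<in> U" using C(2) by blast
  then obtain m where m: "m > 0" "gromov_nbhd cp m a \<subseteq> U"
    using C(1) unfolding openin_gromov_topology by blast
  obtain n where n: "n \<ge> m" "gromov_entourage cp n O gromov_entourage cp n \<subseteq> gromov_entourage cp m"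
    by (rule entourage_comp[OF m(1)])
  have "n > 0" using n(1) m(1) by simp
  have "\<forall>\<^sub>F i in sequentially. i \<ge> n" by (rule eventually_ge_at_top)
  with a(2)[OF \<open>n > 0\<close>] have "\<forall>\<^sub>F i in sequentially. i \<ge> n \<and> (Inl (x i), a) \<in> gromov_entourage cp n"
    by eventually_elim simp
  then obtain i where i: "i \<ge> n" "(Inl (x i), a) \<in> gromov_entourage cp n"
    using eventually_happens'[OF sequentially_bot] by blast
  \<comment> \<open>Through its centre all of \<open>B i\<close> is close to the limit
    \<open>a\<close>, so the single member \<open>U\<close> covers a bad set.\<close>
  have "B i \<subseteq> gromov_nbhd cp m a"
  proof
    fix b assume "b \<in> B i"
    then have "(b, Inl (x i)) \<in> gromov_entourage cp n" using near i(1) \<open>n > 0\<close> by simp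
    then show "b \<in> gromov_nbhd cp m a"
      using subsetD[OF n(2) relcompI[OF _ i(2)]] by (simp add: gromov_nbhd_iff)
  qed
  then have "finite {U} \<and> {U} \<subseteq> C \<and> B i \<subseteq> \<Union>{U}" using m(2) U(1) by auto
  then have "\<exists>F. finite F \<and> F \<subseteq> C \<and> B i \<subseteq> \<Union>F" by (rule exI)
  then show False using B(1)[of i] unfolding bad_def by argo
qed

end

theorem theorem1p8:
  fixes x0 :: "'a :: metric_space" and cp :: "'a \<Rightarrow> 'a \<Rightarrow> real"
  assumes "pre_controlled_product x0 cp"
  shows "compact_space (gromov_topology cp) \<longleftrightarrow>
    (\<forall>S :: 'a set. closed S \<and> bounded S \<longrightarrow> compact S) \<and>
    (\<exists>\<rho>4. control_fun \<rho>4 \<and>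
       (\<forall>R\<ge>0. \<forall>x. x \<notin> cball x0 (\<rho>4 R) \<longrightarrow> (\<exists>y\<in>cball x0 (\<rho>4 R). cp x y \<ge> R)))"
    (is "?C \<longleftrightarrow> ?P \<and> ?R")
proof
  interpret pre_controlled_product x0 cp by fact
  show "?P \<and> ?R" if ?C
    using that compact_space_imp_proper radius_imp_control_fun[OF compact_space_imp_radius] by blast
  show ?C if "?P \<and> ?R"
  proof (rule compact_space_if_finite_nets)
    show "compact S" if "closed S" "bounded S" for S :: "'a set"
      using that \<open>?P \<and> ?R\<close> by blast
    then show "\<exists>A. finite A \<and> gromov_closure cp \<subseteq> (\<Union>x\<in>A. gromov_nbhd cp m (Inl x))" if "m > 0" for m
      using finite_net[OF _ _ that] \<open>?P \<and> ?R\<close> by metis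
  qed
qed

end
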